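(* Let $X$ be a real normed space and let $K\subset X$ be a convex body. Then $\alpha(K,\mathbf{x})=\lambda(K,\mathbf{x})$ for all $\mathbf{x}\in X$.
   Context: $X$ is a real normed space, $X\neq\{0\}$; $X^*$ is its dual and $S^*$ the unit sphere of $X^*$. A convex body is a bounded, closed, convex set with nonempty interior. The support function of $K$ is $h(K,\mathbf{v}^* )=\sup_{\mathbf{x}\in K}\langle \mathbf{v}^*,\mathbf{x}\rangle$, and $w(K,\mathbf{v}^* )=h(K,\mathbf{v}^* )+h(K,-\mathbf{v}^* )$. For $\lambda\ge 0$ and $\mathbf{v}^*\in S^*$, with $r=-h(K,-\mathbf{v}^* )$ and $s=h(K,\mathbf{v}^* )$, set $$L^\lambda(K,\mathbf{v}^* )=\left\{\mathbf{x}\in X:\ \tfrac{\lambda+1}{2}r-\tfrac{\lambda-1}{2}s\le\langle\mathbf{v}^*,\mathbf{x}\rangle\le\tfrac{\lambda+1}{2}s-\tfrac{\lambda-1}{2}r\right\},\qquad K^\lambda=\bigcap_{\mathbf{v}^*\in S^*}L^\lambda(K,\mathbf{v}^* ).$$ The generalized Minkowski functional is $\alpha(K,\mathbf{x})=\inf\{\lambda\ge0:\mathbf{x}\in K^\lambda\}$, which is finite for every $\mathbf{x}\in X$. Further, let $$t(K,\mathbf{v}^*,\mathbf{x})=\frac{2\langle\mathbf{v}^*,\mathbf{x}\rangle-h(K,\mathbf{v}^* )+h(K,-\mathbf{v}^* )}{w(K,\mathbf{v}^* )},\qquad \lambda(K,\mathbf{x})=\sup_{\mathbf{v}^*\in S^*}t(K,\mathbf{v}^*,\mathbf{x})=\sup_{\mathbf{v}^*\in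 S^*}|t(K,\mathbf{v}^*,\mathbf{x})|$$ (the two suprema agree since $t(K,-\mathbf{v}^*,\mathbf{x})=-t(K,\mathbf{v}^*,\mathbf{x})$; equivalently $\lambda(K,\mathbf{x})=\sup\{\eta>0:\exists\,\mathbf{v}^*\in S^*,\ \mathbf{x}\in\partial L^\eta(K,\mathbf{v}^* )\}$, with value $0$ if there is no such $\eta$). *)

theory Defs
  imports "HOL-Analysis.Analysis"
begin

definition convex_body :: "'a::real_normed_vector set \<Rightarrow> bool" where
  "convex_body K \<longleftrightarrow> bounded K \<and> closed K \<and> convex K \<and> interior K \<noteq> {}"

text \<open>The dual space is the type of bounded linear functionals with the operator norm.\<close>

definition dual_unit_sphere :: "('a::real_normed_vector \<Rightarrow>\<^sub>L real) set" where
  "dual_unit_sphere = sphere 0 1"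

definition support_fun :: "'a::real_normed_vector set \<Rightarrow> ('a \<Rightarrow>\<^sub>L real) \<Rightarrow> real" where
  "support_fun K v = (SUP x\<in>K. blinfun_apply v x)"

definition width_fun :: "'a::real_normed_vector set \<Rightarrow> ('a \<Rightarrow>\<^sub>L real) \<Rightarrow> real" where
  "width_fun K v = support_fun K v + support_fun K (- v)"

definition scaled_layer ::
  "real \<Rightarrow> 'a::real_normed_vector set \<Rightarrow> ('a \<Rightarrow>\<^sub>L real) \<Rightarrow> 'a set" where
  "scaled_layer l K v =
     (let r = - support_fun K (- v); s = support_fun K v in
      {x. (l + 1) / 2 * r - (l - 1) / 2 * s \<le> blinfun_apply v x \<and>
          blinfun_apply v x \<le> (l + 1) / 2 * s - (l - 1) / 2 * r})"

definition scaled_body :: "real \<Rightarrow> 'a::real_normed_vector set \<Rightarrow> 'a set" where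
  "scaled_body l K = (\<Inter>v\<in>dual_unit_sphere. scaled_layer l K v)"

definition minkowski_functional :: "'a::real_normed_vector set \<Rightarrow> 'a \<Rightarrow> real" where
  "minkowski_functional K x = Inf {l. 0 \<le> l \<and> x \<in> scaled_body l K}"

definition layer_ratio ::
  "'a::real_normed_vector set \<Rightarrow> ('a \<Rightarrow>\<^sub>L real) \<Rightarrow> 'a \<Rightarrow> real" where
  "layer_ratio K v x =
     (2 * blinfun_apply v x - support_fun K v + support_fun K (- v)) / width_fun K v"

definition layer_functional :: "'a::real_normed_vector set \<Rightarrow> 'a \<Rightarrow> real" where
  "layer_functional K x = (SUP v\<in>dual_unit_sphere. layer_ratio K v x)"

text \<open>
  All suprema and infima above are taken in the reals. For a convex body in a nonzero space
  they are taken over nonempty bounded sets; the bounds and the nonemptiness of the set in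
  \<open>minkowski_functional\<close> are shown next. The dual unit sphere is nonempty
  by the Hahn-Banach theorem.
\<close>

lemma bdd_above_support:
  fixes K :: "'a::real_normed_vector set" and v :: "'a \<Rightarrow>\<^sub>L real"
  assumes "bounded K"
  shows "bdd_above (blinfun_apply v ` K)"
proof -
  obtain B where B: "\<And>x. x \<in> K \<Longrightarrow> norm x \<le> B"
    using assms by (auto simp: bounded_iff)
  have "blinfun_apply v x \<le> norm v * B" if "x \<in> K" for x
  proof -
    have "blinfun_apply v x \<le> norm v * norm x"
      using norm_blinfun[of v x] by simp
    also have "\<dots> \<le> norm v * B"
      using B[OF that] by (simp add: mult_left_mono)
    finally show ?thesis .
  qed
  then show ?thesis by (auto simp: bdd_above_def)
qed

lemma le_support_fun:
  "bounded K \<Longrightarrow> x \<in> K \<Longrightarrow> blinfun_apply v x \<le> support_fun K v"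
  unfolding support_fun_def by (intro cSUP_upper bdd_above_support)

lemma width_fun_lower_bound:
  fixes K :: "'a::real_normed_vector set"
  assumes K: "bounded K" and b: "cball c e \<subseteq> K" and e: "0 < e" and v: "norm v = 1"
  shows "2 * e \<le> width_fun K v"
proof -
  have "norm v \<le> width_fun K v / (2 * e)"
  proof (rule norm_blinfun_bound)
    have *: "2 * e * \<bar>blinfun_apply v u\<bar> \<le> width_fun K v * norm u" for u
    proof (cases "u = 0")
      case False
      define d where "d = (e / norm u) *\<^sub>R u"
      have d: "c + d \<in> K" "c - d \<in> K"
        using b e False by (auto simp: subset_eq d_def dist_norm)
      have "v (c + d) \<le> support_fun K v" "v (c - d) \<le> support_fun K v"
        "(- v) (c + d) \<le> support_fun K (- v)" "(- v) (c - d) \<le> support_fun K (- v)"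
        using K d by (simp_all only: le_support_fun)
      then have "2 * \<bar>v d\<bar> \<le> width_fun K v"
        by (auto simp: width_fun_def blinfun.bilinear_simps)
      then show ?thesis
        using e False by (simp add: d_def blinfun.bilinear_simps abs_mult field_simps)
    qed simp
    show "norm (blinfun_apply v u) \<le> width_fun K v / (2 * e) * norm u" for u
      using *[of u] e by (simp add: field_simps)
    have "c \<in> K" using b e by auto
    then have "v c \<le> support_fun K v" "(- v) c \<le> support_fun K (- v)"
      using K by (simp_all only: le_support_fun)
    then show "0 \<le> width_fun K v / (2 * e)"
      using e by (simp add: width_fun_def blinfun.bilinear_simps)
  qed
  then show ?thesis using e v by (simp add: field_simps)
qed

lemma width_fun_pos:
  assumes "convex_body K" "v \<in> dual_unit_sphere"
  shows "0 < width_fun K v"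
proof -
  obtain c e where "0 < e" "cball c e \<subseteq> K"
    using assms(1) by (auto simp: convex_body_def mem_interior_cball)
  then show ?thesis
    using assms width_fun_lower_bound[of K c e v]
    by (auto simp: convex_body_def dual_unit_sphere_def)
qed

lemma layer_ratio_uminus: "layer_ratio K (- v) x = - layer_ratio K v x"
  by (simp add: layer_ratio_def width_fun_def blinfun.bilinear_simps minus_divide_left
      add.commute)

lemma mem_scaled_layer_iff:
  assumes "0 < width_fun K v"
  shows "x \<in> scaled_layer l K v \<longleftrightarrow> \<bar>layer_ratio K v x\<bar> \<le> l"
  using assms unfolding scaled_layer_def Let_def layer_ratio_def abs_le_iff width_fun_def
  by (auto simp: field_simps)

lemma layer_ratio_bounded:
  fixes K :: "'a::real_normed_vector set"
  assumes "convex_body K"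
  obtains B where "0 \<le> B" "\<And>v. v \<in> dual_unit_sphere \<Longrightarrow> \<bar>layer_ratio K v x\<bar> \<le> B"
proof -
  from assms have K: "bounded K" "K \<noteq> {}"
    using interior_subset[of K] by (auto simp: convex_body_def)
  obtain c e where e: "0 < e" "cball c e \<subseteq> K"
    using assms by (auto simp: convex_body_def mem_interior_cball)
  obtain M where M: "\<And>y. y \<in> K \<Longrightarrow> norm y \<le> M"
    using K by (auto simp: bounded_iff)
  have cK: "c \<in> K" using e by auto
  have M0: "0 \<le> M" using M[OF cK] norm_ge_zero[of c] by linarith
  have h: "\<bar>support_fun K v\<bar> \<le> M" if v: "norm v = 1" for v
  proof -
    have n: "\<bar>blinfun_apply v y\<bar> \<le> M" if "y \<in> K" for y
      using norm_blinfun[of v y] M[OF that] v by simp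
    have "support_fun K v \<le> M"
      unfolding support_fun_def using K n by (intro cSUP_least) (auto simp: abs_le_iff)
    moreover have "- M \<le> support_fun K v"
      using n[OF cK] le_support_fun[OF K(1) cK, of v] by linarith
    ultimately show ?thesis by (simp add: abs_le_iff)
  qed
  show ?thesis
  proof (rule that)
    show "0 \<le> (2 * norm x + 2 * M) / (2 * e)"
      using e M0 by simp
    fix v :: "'a \<Rightarrow>\<^sub>L real" assume "v \<in> dual_unit_sphere"
    then have v: "norm v = 1" by (simp add: dual_unit_sphere_def)
    have w: "2 * e \<le> width_fun K v"
      using width_fun_lower_bound[OF K(1) e(2,1) v] .
    have vx: "\<bar>blinfun_apply v x\<bar> \<le> norm x" using norm_blinfun[of v x] v by simp
    have "\<bar>2 * blinfun_apply v x - support_fun K v + support_fun K (- v)\<bar> \<le> 2 * norm x + 2 * M"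
      using vx h[of v] h[of "- v"] v by (simp add: abs_le_iff)
    then show "\<bar>layer_ratio K v x\<bar> \<le> (2 * norm x + 2 * M) / (2 * e)"
      unfolding layer_ratio_def abs_divide
      using w e by (intro frac_le) auto
  qed
qed

lemma bdd_above_layer_ratio:
  assumes "convex_body K"
  shows "bdd_above ((\<lambda>v. layer_ratio K v x) ` dual_unit_sphere)"
proof -
  obtain B where "\<And>v. v \<in> dual_unit_sphere \<Longrightarrow> \<bar>layer_ratio K v x\<bar> \<le> B"
    using layer_ratio_bounded[OF assms] by metis
  then show ?thesis by (intro bdd_aboveI2[where M = B]) (auto simp: abs_le_iff)
qed

lemma minkowski_functional_set_nonempty:
  assumes "convex_body K"
  shows "{l. 0 \<le> l \<and> x \<in> scaled_body l K} \<noteq> {}"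
proof -
  obtain B where "0 \<le> B" "\<And>v. v \<in> dual_unit_sphere \<Longrightarrow> \<bar>layer_ratio K v x\<bar> \<le> B"
    using layer_ratio_bounded[OF assms] by metis
  then have "B \<in> {l. 0 \<le> l \<and> x \<in> scaled_body l K}"
    by (auto simp: scaled_body_def mem_scaled_layer_iff width_fun_pos[OF assms])
  then show ?thesis by blast
qed

end

theory Submission
  imports Defs
begin

text \<open>
  Write \<open>t v = layer_ratio K v x\<close>. A point \<open>x\<close> lies in the layer \<open>scaled_layer l K v\<close> iff
  \<open>\<bar>t v\<bar> \<le> l\<close>. The dual unit sphere is symmetric and \<open>t\<close> is odd in \<open>v\<close>, so lying in all the layers
  means that \<open>l\<close> is an upper bound of the values \<open>t v\<close>. Such a bound is automatically nonnegative,
  because it bounds some \<open>t v\<close> and also \<open>- t v\<close>. Hence the set whose infimum is the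
  Minkowski functional is the ray \<open>{layer_functional K x..}\<close>.

  This needs some unit functional to exist; over an empty sphere the supremum would say nothing.
  A nonzero bounded functional is obtained as in the Hahn-Banach theorem, in the following form: a
  minimal sublinear function is odd (\<open>minimal_sublinear_odd\<close>), an odd sublinear function is linear,
  and by Zorn's lemma there is a minimal one below each sublinear function
  (\<open>exists_minimal_sublinear\<close>). Both oddness and nontriviality come from a single construction,
  \<open>tilt\<close>, which lowers a sublinear function \<open>p\<close> so that its value at \<open>- y\<close> becomes at most
  \<open>- p y\<close>. Starting from the norm tilted at some \<open>u \<noteq> 0\<close>, the minimal function is bounded by the
  norm and is negative at \<open>- u\<close>.
\<close>

section \<open>Sublinear functions\<close>

text \<open>
  One inequality suffices for positive homogeneity: applied to \<open>1 / c\<close> it yields the other.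
\<close>

definition sublinear :: "('a::real_vector \<Rightarrow> real) \<Rightarrow> bool" where
  "sublinear p \<longleftrightarrow> (\<forall>x y. p (x + y) \<le> p x + p y) \<and> (\<forall>c>0. \<forall>x. p (c *\<^sub>R x) \<le> c * p x)"

lemma sublinear_add: "sublinear p \<Longrightarrow> p (x + y) \<le> p x + p y"
  by (simp add: sublinear_def)

lemma sublinear_scaleR:
  assumes p: "sublinear p" and c: "0 \<le> c"
  shows "p (c *\<^sub>R x) = c * p x"
proof (cases "c = 0")
  case True
  have h: "p 0 \<le> c * p 0" if "0 < c" for c
    using p that unfolding sublinear_def by (metis scaleR_zero_right)
  have "p 0 = 0" using h[of 2] h[of "1 / 2"] by simp
  then show ?thesis using True by simp
next
  case False
  then have c: "0 < c" using c by simp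
  have "p x = p ((1 / c) *\<^sub>R (c *\<^sub>R x))" using c by simp
  also have "\<dots> \<le> (1 / c) * p (c *\<^sub>R x)"
    using p c unfolding sublinear_def by (meson divide_pos_pos zero_less_one)
  finally have "c * p x \<le> p (c *\<^sub>R x)" using c by (simp add: field_simps)
  moreover have "p (c *\<^sub>R x) \<le> c * p x" using p c by (simp add: sublinear_def)
  ultimately show ?thesis by simp
qed

lemma sublinear_uminus_ge:
  assumes "sublinear p"
  shows "- p (- x) \<le> p x"
  using sublinear_add[OF assms, of x "- x"] sublinear_scaleR[OF assms, of 0 0] by simp

lemma sublinear_norm: "sublinear (norm :: 'a::real_normed_vector \<Rightarrow> real)"
  by (simp add: sublinear_def norm_triangle_ineq)

lemma linear_if_sublinear_odd:
  assumes p: "sublinear p" and odd: "\<And>x. p (- x) = - p x"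
  shows "linear p"
proof (rule linearI)
  show "p (x + y) = p x + p y" for x y
    using sublinear_add[OF p, of x y] sublinear_add[OF p, of "x + y" "- y"] odd[of y] by simp
  show "p (c *\<^sub>R x) = c *\<^sub>R p x" for c x
  proof (cases "0 \<le> c")
    case False
    then show ?thesis
      using sublinear_scaleR[OF p, of "- c" x] odd[of "c *\<^sub>R x"] by simp
  qed (simp add: sublinear_scaleR[OF p])
qed

section \<open>Tilting a sublinear function\<close>

text \<open>
  The largest sublinear function \<open>q \<le> p\<close> with \<open>q (- y) \<le> - p y\<close>: any such \<open>q\<close> satisfies
  \<open>q x \<le> q (x + t y) + t q (- y) \<le> p (x + t y) - t p y\<close> for all \<open>t \<ge> 0\<close>.
\<close>

definition tilt :: "('a::real_vector \<Rightarrow> real) \<Rightarrow> 'a \<Rightarrow> 'a \<Rightarrow> real" where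
  "tilt p y x = (INF t\<in>{0..}. p (x + t *\<^sub>R y) - t * p y)"

lemma bdd_below_tilt:
  assumes "sublinear p"
  shows "bdd_below ((\<lambda>t. p (x + t *\<^sub>R y) - t * p y) ` {0..})"
proof (rule bdd_belowI2)
  fix t :: real assume "t \<in> {0..}"
  then show "- p (- x) \<le> p (x + t *\<^sub>R y) - t * p y"
    using sublinear_add[OF assms, of "x + t *\<^sub>R y" "- x"] sublinear_scaleR[OF assms, of t y]
    by simp
qed

lemma tilt_le:
  assumes "sublinear p" "0 \<le> t"
  shows "tilt p y x \<le> p (x + t *\<^sub>R y) - t * p y"
  unfolding tilt_def using assms by (intro cINF_lower bdd_below_tilt) auto

lemma tilt_greatest:
  assumes "\<And>t. 0 \<le> t \<Longrightarrow> b \<le> p (x + t *\<^sub>R y) - t * p y"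
  shows "b \<le> tilt p y x"
  unfolding tilt_def using assms by (intro cINF_greatest) auto

lemma tilt_le_self:
  assumes "sublinear p"
  shows "tilt p y x \<le> p x"
  using tilt_le[OF assms, of 0] by simp

lemma tilt_uminus_le:
  assumes "sublinear p"
  shows "tilt p y (- y) \<le> - p y"
  using tilt_le[OF assms, of 1 y "- y"] sublinear_scaleR[OF assms, of 0 0] by simp

lemma sublinear_tilt:
  assumes p: "sublinear p"
  shows "sublinear (tilt p y)"
  unfolding sublinear_def
proof (intro conjI allI impI)
  fix x z
  have *: "tilt p y (x + z) \<le> (p (x + s *\<^sub>R y) - s * p y) + (p (z + t *\<^sub>R y) - t * p y)"
    if "0 \<le> s" "0 \<le> t" for s t
  proof -
    have "tilt p y (x + z) \<le> p ((x + s *\<^sub>R y) + (z + t *\<^sub>R y)) - (s + t) * p y"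
      using tilt_le[OF p, of "s + t" y "x + z"] that by (simp add: algebra_simps)
    then show ?thesis
      using sublinear_add[OF p, of "x + s *\<^sub>R y" "z + t *\<^sub>R y"] by (simp add: algebra_simps)
  qed
  have "tilt p y (x + z) - (p (x + s *\<^sub>R y) - s * p y) \<le> tilt p y z" if "0 \<le> s" for s
    using *[OF that] by (intro tilt_greatest) (simp add: algebra_simps)
  then have "tilt p y (x + z) - tilt p y z \<le> tilt p y x"
    by (intro tilt_greatest) (simp add: algebra_simps)
  then show "tilt p y (x + z) \<le> tilt p y x + tilt p y z" by simp
next
  fix c :: real and x assume c: "0 < c"
  have "tilt p y (c *\<^sub>R x) / c \<le> tilt p y x"
  proof (rule tilt_greatest)
    fix t :: real assume t: "0 \<le> t"
    have "tilt p y (c *\<^sub>R x) \<le> p (c *\<^sub>R x + (c * t) *\<^sub>R y) - (c * t) * p y"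
      using tilt_le[OF p] c t by simp
    also have "\<dots> = c * (p (x + t *\<^sub>R y) - t * p y)"
      using sublinear_scaleR[OF p, of c "x + t *\<^sub>R y"] c by (simp add: algebra_simps)
    finally show "tilt p y (c *\<^sub>R x) / c \<le> p (x + t *\<^sub>R y) - t * p y"
      using c by (simp add: field_simps)
  qed
  then show "tilt p y (c *\<^sub>R x) \<le> c * tilt p y x" using c by (simp add: field_simps)
qed

section \<open>Minimal sublinear functions\<close>

text \<open>A minimal \<open>p\<close> equals each of its tilts, and tilting at \<open>x\<close> brings the value at \<open>- x\<close> down to
  \<open>- p x\<close>, the least that subadditivity permits.\<close>

lemma minimal_sublinear_odd:
  assumes p: "sublinear p" and min: "\<And>q. sublinear q \<Longrightarrow> q \<le> p \<Longrightarrow> q = p"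
  shows "p (- x) = - p x"
proof -
  have "tilt p x = p"
    using tilt_le_self[OF p] by (intro min sublinear_tilt p) (simp add: le_fun_def)
  then show ?thesis
    using tilt_uminus_le[OF p, of x] sublinear_uminus_ge[OF p, of x] by simp
qed

text \<open>
  Along a chain the pointwise infimum is sublinear: for subadditivity, two members of the chain
  may be replaced by the smaller of them.
\<close>

lemma sublinear_INF_chain:
  fixes C :: "('a::real_vector \<Rightarrow> real) set"
  assumes C: "C \<noteq> {}" "\<And>p. p \<in> C \<Longrightarrow> sublinear p"
    and chain: "\<And>p q. p \<in> C \<Longrightarrow> q \<in> C \<Longrightarrow> p \<le> q \<or> q \<le> p"
    and bdd: "\<And>x. bdd_below ((\<lambda>p. p x) ` C)"
  shows "sublinear (\<lambda>x. INF p\<in>C. p x)"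
  unfolding sublinear_def
proof (intro conjI allI impI)
  have low: "(INF p\<in>C. p x) \<le> p x" if "p \<in> C" for p x
    using that bdd by (rule cINF_lower[rotated])
  fix x y
  have *: "(INF p\<in>C. p (x + y)) \<le> p x + q y" if pq: "p \<in> C" "q \<in> C" for p q
  proof -
    obtain r where r: "r \<in> C" "r \<le> p" "r \<le> q"
      using chain[OF pq] pq by blast
    have "(INF p\<in>C. p (x + y)) \<le> r x + r y"
      using low[OF r(1)] sublinear_add[OF C(2)[OF r(1)]] by (rule order_trans)
    also have "\<dots> \<le> p x + q y"
      using r by (intro add_mono) (simp_all add: le_fun_def)
    finally show ?thesis .
  qed
  have "(INF p\<in>C. p (x + y)) - p x \<le> (INF q\<in>C. q y)" if "p \<in> C" for p
    using C(1) *[OF that] by (intro cINF_greatest) (simp_all add: algebra_simps)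
  then have "(INF p\<in>C. p (x + y)) - (INF q\<in>C. q y) \<le> (INF p\<in>C. p x)"
    using C(1) by (intro cINF_greatest) (simp_all add: algebra_simps)
  then show "(INF p\<in>C. p (x + y)) \<le> (INF p\<in>C. p x) + (INF p\<in>C. p y)" by simp
next
  have low: "(INF p\<in>C. p x) \<le> p x" if "p \<in> C" for p x
    using that bdd by (rule cINF_lower[rotated])
  fix c :: real and x assume c: "0 < c"
  have "(INF p\<in>C. p (c *\<^sub>R x)) / c \<le> (INF p\<in>C. p x)"
  proof (rule cINF_greatest[OF C(1)])
    fix p assume p: "p \<in> C"
    show "(INF p\<in>C. p (c *\<^sub>R x)) / c \<le> p x"
      using low[OF p, of "c *\<^sub>R x"] sublinear_scaleR[OF C(2)[OF p], of c x] c
      by (simp add: field_simps)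
  qed
  then show "(INF p\<in>C. p (c *\<^sub>R x)) \<le> c * (INF p\<in>C. p x)" using c by (simp add: field_simps)
qed

lemma exists_minimal_sublinear:
  fixes p :: "'a::real_vector \<Rightarrow> real"
  assumes p: "sublinear p"
  obtains m where "sublinear m" "m \<le> p" "\<And>q. sublinear q \<Longrightarrow> q \<le> m \<Longrightarrow> q = m"
proof -
  define A where "A = {q. sublinear q \<and> q \<le> p}"
  \<comment> \<open>Zorn's lemma yields maximal elements, so the order on \<open>A\<close> is reversed.\<close>
  have "\<exists>m\<in>A. \<forall>q\<in>A. q \<le> m \<longrightarrow> q = m"
  proof (rule predicate_Zorn[where P = "\<lambda>q r. r \<le> q"])
    show "partial_order_on A (relation_of (\<lambda>q r. r \<le> q) A)"
      by (rule partial_order_on_relation_ofI) auto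
    fix C assume C: "C \<in> Chains (relation_of (\<lambda>q r. r \<le> q) A)"
    have CA: "C \<subseteq> A" using C by (auto simp: Chains_def relation_of_def)
    have chain: "q \<le> r \<or> r \<le> q" if "q \<in> C" "r \<in> C" for q r
      using C that by (auto simp: Chains_def relation_of_def)
    show "\<exists>u\<in>A. \<forall>q\<in>C. u \<le> q"
    proof (cases "C = {}")
      case True
      then show ?thesis using p by (auto simp: A_def)
    next
      case False
      have bdd: "bdd_below ((\<lambda>q. q x) ` C)" for x
      proof (rule bdd_belowI2)
        fix q assume "q \<in> C"
        then have "sublinear q" "q (- x) \<le> p (- x)" using CA by (auto simp: A_def le_fun_def)
        then show "- p (- x) \<le> q x" using sublinear_uminus_ge[of q x] by linarith
      qed
      define u where "u = (\<lambda>x. INF q\<in>C. q x)"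
      have low: "u \<le> q" if "q \<in> C" for q
        unfolding u_def le_fun_def using that bdd by (intro allI cINF_lower)
      have "sublinear u"
        unfolding u_def using False CA chain bdd
        by (intro sublinear_INF_chain) (auto simp: A_def)
      moreover obtain q where "q \<in> C" using False by blast
      then have "u \<le> p" using low[of q] CA by (auto simp: A_def)
      ultimately show ?thesis using low by (auto simp: A_def)
    qed
  qed
  then obtain m where m: "m \<in> A" "\<And>q. q \<in> A \<Longrightarrow> q \<le> m \<Longrightarrow> q = m" by blast
  show ?thesis
  proof (rule that[of m])
    show "sublinear m" "m \<le> p" using m(1) by (auto simp: A_def)
    then show "q = m" if "sublinear q" "q \<le> m" for q
      using m(2) that by (auto simp: A_def)
  qed
qed

section \<open>Unit functionals\<close>

lemma dual_unit_sphere_nonempty: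
  assumes "\<exists>u::'a::real_normed_vector. u \<noteq> 0"
  shows "(dual_unit_sphere :: ('a \<Rightarrow>\<^sub>L real) set) \<noteq> {}"
proof -
  obtain u :: 'a where u: "u \<noteq> 0" using assms by blast
  obtain f where f: "sublinear f" "f \<le> tilt norm u"
    and min: "\<And>q. sublinear q \<Longrightarrow> q \<le> f \<Longrightarrow> q = f"
    by (rule exists_minimal_sublinear[OF sublinear_tilt[OF sublinear_norm, of u]]) blast
  have odd: "f (- x) = - f x" for x using minimal_sublinear_odd[OF f(1) min] .
  have le: "f x \<le> norm x" for x
    using f(2) tilt_le_self[OF sublinear_norm, of u x] unfolding le_fun_def
    by (meson order_trans)
  have "norm (f x) \<le> norm x * 1" for x
    using le[of x] le[of "- x"] odd[of x] by (simp add: abs_le_iff)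
  then have bl: "bounded_linear f"
    using linear_if_sublinear_odd[OF f(1) odd] unfolding bounded_linear_def bounded_linear_axioms_def
    by blast
  define g where "g = Blinfun f"
  have g: "blinfun_apply g = f" unfolding g_def using bl by (rule bounded_linear_Blinfun_apply)
  have "f (- u) \<le> tilt norm u (- u)" using f(2) by (simp add: le_fun_def)
  then have "f (- u) < 0"
    using tilt_uminus_le[OF sublinear_norm, of u] u by (smt (verit) zero_less_norm_iff)
  then have "g \<noteq> 0" using g by auto
  then have "(1 / norm g) *\<^sub>R g \<in> dual_unit_sphere" by (simp add: dual_unit_sphere_def)
  then show ?thesis by blast
qed

section \<open>The two functionals agree\<close>

text \<open>Only the upper bounds \<open>t v \<le> l\<close> remain, since \<open>- t v = t (- v)\<close> turns
  the lower bounds into upper bounds at the opposite functional.\<close>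

lemma mem_scaled_body_iff:
  assumes "convex_body K"
  shows "x \<in> scaled_body l K \<longleftrightarrow> (\<forall>v\<in>dual_unit_sphere. layer_ratio K v x \<le> l)"
proof -
  have "x \<in> scaled_body l K \<longleftrightarrow> (\<forall>v\<in>dual_unit_sphere. \<bar>layer_ratio K v x\<bar> \<le> l)"
    by (simp add: scaled_body_def mem_scaled_layer_iff width_fun_pos[OF assms])
  also have "\<dots> \<longleftrightarrow> (\<forall>v\<in>dual_unit_sphere. layer_ratio K v x \<le> l)"
  proof (intro iffI ballI)
    fix v :: "'a \<Rightarrow>\<^sub>L real" assume v: "v \<in> dual_unit_sphere"
    show "layer_ratio K v x \<le> l" if "\<forall>v\<in>dual_unit_sphere. \<bar>layer_ratio K v x\<bar> \<le> l"
      using that v by (simp add: abs_le_iff)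
    show "\<bar>layer_ratio K v x\<bar> \<le> l" if h: "\<forall>v\<in>dual_unit_sphere. layer_ratio K v x \<le> l"
    proof -
      have "- v \<in> dual_unit_sphere" using v by (simp add: dual_unit_sphere_def)
      then show ?thesis
        using h v layer_ratio_uminus[of K v x] by (metis abs_le_iff)
    qed
  qed
  finally show ?thesis .
qed

theorem proposition4p1:
  fixes K :: "'a::real_normed_vector set"
  assumes nontrivial: "\<exists>u::'a. u \<noteq> 0"
    and body: "convex_body K"
  shows "\<forall>x. minkowski_functional K x = layer_functional K x"
proof
  fix x
  have ne: "(dual_unit_sphere :: ('a \<Rightarrow>\<^sub>L real) set) \<noteq> {}"
    using dual_unit_sphere_nonempty[OF nontrivial] .
  have body_iff: "x \<in> scaled_body l K \<longleftrightarrow> layer_functional K x \<le> l" for l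
    unfolding layer_functional_def mem_scaled_body_iff[OF body]
    by (rule cSUP_le_iff[OF ne bdd_above_layer_ratio[OF body], symmetric])
  have "0 \<le> layer_functional K x"
  proof -
    obtain v :: "'a \<Rightarrow>\<^sub>L real" where v: "v \<in> dual_unit_sphere" using ne by blast
    have "x \<in> scaled_layer (layer_functional K x) K v"
      using body_iff[of "layer_functional K x"] v by (simp add: scaled_body_def)
    then show ?thesis
      using mem_scaled_layer_iff[OF width_fun_pos[OF body v]] abs_ge_zero order_trans by blast
  qed
  then have "{l. 0 \<le> l \<and> x \<in> scaled_body l K} = {layer_functional K x..}"
    by (auto simp: body_iff)
  then show "minkowski_functional K x = layer_functional K x"
    by (simp add: minkowski_functional_def)
qed

end
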